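(* Let $(\mathcal{M},g,K)$ be an optical geometry with associated congruence of null geodesics $\mathcal{K}$. Let $\mathring{T}$ be the intrinsic torsion of the optical structure. Then (1) the expansion of $\mathcal{K}$ is the image of the projection of $\mathring{T}$ to $\mathcal{G}_{-1}^0$; (2) the twist of $\mathcal{K}$ is the image of the projection of $\mathring{T}$ to $\mathcal{G}_{-1}^1$; (3) the shear of $\mathcal{K}$ is the image of the projection of $\mathring{T}$ to $\mathcal{G}_{-1}^2$.
   Context: An optical geometry $(\mathcal{M},g,K)$ is an oriented and time-oriented Lorentzian manifold $(\mathcal{M},g)$ of dimension $n+2$ with a null line distribution $K\subset T\mathcal{M}$. $\nabla$ is the Levi-Civita connection, $H_K=K^\perp/K$ the screen bundle with induced positive definite metric $h(v+K,w+K)=g(v,w)$. $\mathcal{K}$ is the foliation by curves tangent to $K$; a generator is a non-vanishing section $k$ of $K$, and here its curves are geodesics, i.e. $\nabla_kk\in\Gamma(K)$. $\mathcal{E}(1)$ denotes the line bundle of boost densities of weight $1$: sections are represented, for each generator $k$, by functions $f_k$ with $f_{bk}=b\,f_k$ (so $\mathcal{E}(1)\cong K^*$); $F(1)=F\otimes\mathcal{E}(1)$. For a generator $k$ with $\kappa=g(k,\cdot)$, the expansion $\epsilon$, twist $\tau$ and shear $\sigma$ of $k$ are defined, for $v,w\in\Gamma(K^\perp)$, by $\epsilon\,\kappa=\kappa\,\mathrm{div}\,k-\nabla_k\kappa$, $\ \tau(v+K,w+K)=\mathrm{d}\kappa(v,w)$, $\ \sigma(v+K,w+K)=\frac12\mathcal{L}_kg(v,w)-\frac1n\epsilon\,g(v,w)$,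 with the convention $(\mathrm{d}\kappa)_{ab}=\nabla_{[a}\kappa_{b]}=\frac12(\nabla_a\kappa_b-\nabla_b\kappa_a)$. The expansion, twist and shear of $\mathcal{K}$ are the sections of $\mathcal{E}(1)$, $\bigwedge^2H_K^*(1)$ and $\odot^2_\circ H_K^*(1)$ (trace-free symmetric) represented for each generator $k$ by $\epsilon,\tau,\sigma$. The intrinsic torsion is the section $\mathring T$ of $\mathcal{G}=T^*\mathcal{M}\otimes H_K^*(1)$ represented, for a generator $k$, by $\mathring T(v;w+K)=(\nabla_v\kappa)(w)$, $v\in\Gamma(T\mathcal{M})$, $w\in\Gamma(K^\perp)$. Since $\mathcal{K}$ is geodesic, $\mathring T$ lies in $\mathcal{G}^{-1}=\mathrm{Ann}(K)\otimes H_K^*(1)$ and projects to $\mathcal{G}^{-1}/\mathcal{G}^0\cong H_K^*\otimes H_K^*(1)$, where $\mathcal{G}^0=\mathrm{Ann}(K^\perp)\otimes H_K^*(1)$. The projections of $A_{ij}\in H_K^*\otimes H_K^*(1)$ to $\mathcal{G}_{-1}^0\cong\mathcal{E}(1)$, $\mathcal{G}_{-1}^1\cong\bigwedge^2H_K^*(1)$, $\mathcal{G}_{-1}^2\cong\odot^2_\circ H_K^*(1)$ are $h^{ij}A_{ij}$, $A_{[ij]}$, and the trace-free part $A_{(ij)_\circ}$ of $A_{(ij)}$. *)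

theory Defs
  imports "HOL-Analysis.Analysis"
begin

section \<open>Smooth manifolds\<close>

text \<open>All sets to which the next two notions are applied are open, so that the derivatives are
  two-sided.\<close>

primrec Ck_on :: "nat \<Rightarrow> 'e::real_normed_vector set \<Rightarrow> ('e \<Rightarrow> 'f::real_normed_vector) \<Rightarrow> bool" where
  "Ck_on 0 S f \<longleftrightarrow> continuous_on S f"
| "Ck_on (Suc k) S f \<longleftrightarrow>
     (\<forall>x\<in>S. f differentiable (at x)) \<and> (\<forall>v. Ck_on k S (\<lambda>x. frechet_derivative f (at x) v))"

definition smooth_on :: "'e::real_normed_vector set \<Rightarrow> ('e \<Rightarrow> 'f::real_normed_vector) \<Rightarrow> bool" where
  "smooth_on S f \<longleftrightarrow> (\<forall>k. Ck_on k S f)"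

text \<open>A chart is a pair of its domain and its coordinate map; the values of the coordinate map
  outside the domain are irrelevant. The manifold is the whole type \<open>'a\<close>.\<close>

type_synonym ('a, 'm) chart = "'a set \<times> ('a \<Rightarrow> real^'m)"

definition chart_inv :: "('a, 'm::finite) chart \<Rightarrow> real^'m \<Rightarrow> 'a" where
  "chart_inv c = inv_into (fst c) (snd c)"

definition is_chart :: "('a::topological_space, 'm::finite) chart \<Rightarrow> bool" where
  "is_chart c \<longleftrightarrow> open (fst c) \<and> open (snd c ` fst c) \<and>
     homeomorphism (fst c) (snd c ` fst c) (snd c) (chart_inv c)"

definition transition :: "('a, 'm::finite) chart \<Rightarrow> ('a, 'm) chart \<Rightarrow> real^'m \<Rightarrow> real^'m" where
  "transition c d = snd d \<circ> chart_inv c"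

text \<open>An oriented manifold is given by an atlas whose transition maps are smooth and have
  everywhere positive Jacobian determinant.\<close>

definition oriented_smooth_atlas :: "('a::topological_space, 'm::finite) chart set \<Rightarrow> bool" where
  "oriented_smooth_atlas A \<longleftrightarrow>
     (\<forall>c\<in>A. is_chart c) \<and> (\<Union>c\<in>A. fst c) = UNIV \<and>
     (\<forall>c\<in>A. \<forall>d\<in>A. smooth_on (snd c ` (fst c \<inter> fst d)) (transition c d) \<and>
        (\<forall>x \<in> snd c ` (fst c \<inter> fst d).
           det (matrix (frechet_derivative (transition c d) (at x))) > 0))"

definition smooth_fun_on :: "('a::topological_space, 'm::finite) chart set \<Rightarrow> 'a set \<Rightarrow> ('a \<Rightarrow> real) \<Rightarrow> bool" where
  "smooth_fun_on A U f \<longleftrightarrow> open U \<and> (\<forall>c\<in>A. smooth_on (snd c ` (fst c \<inter> U)) (f \<circ> chart_inv c))"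

text \<open>Every tangent space is modelled on \<open>real^'m\<close>: a tangent vector at \<open>p\<close> is given by its
  components in one chart around \<open>p\<close> that is chosen once and for all, and its components in any
  other chart are obtained from the Jacobian of the transition map. A vector field is thus a
  function \<open>'a \<Rightarrow> real^'m\<close>; its smoothness refers to the components in the charts of the atlas,
  not to this function itself, since the chosen chart may jump from point to point.\<close>

definition chart_at :: "('a, 'm::finite) chart set \<Rightarrow> 'a \<Rightarrow> ('a, 'm) chart" where
  "chart_at A p = (SOME c. c \<in> A \<and> p \<in> fst c)"

definition vec_coords :: "('a, 'm::finite) chart set \<Rightarrow> ('a, 'm) chart \<Rightarrow> 'a \<Rightarrow> real^'m \<Rightarrow> real^'m" where
  "vec_coords A c p v =
     frechet_derivative (transition (chart_at A p) c) (at (snd (chart_at A p) p)) v"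

definition smooth_field_on :: "('a::topological_space, 'm::finite) chart set \<Rightarrow> 'a set \<Rightarrow> ('a \<Rightarrow> real^'m) \<Rightarrow> bool" where
  "smooth_field_on A U X \<longleftrightarrow> open U \<and>
     (\<forall>c\<in>A. smooth_on (snd c ` (fst c \<inter> U))
        (\<lambda>x. vec_coords A c (chart_inv c x) (X (chart_inv c x))))"

definition smooth_fun_near :: "('a::topological_space, 'm::finite) chart set \<Rightarrow> 'a \<Rightarrow> ('a \<Rightarrow> real) \<Rightarrow> bool" where
  "smooth_fun_near A p f \<longleftrightarrow> (\<exists>U. p \<in> U \<and> smooth_fun_on A U f)"

definition smooth_field_near :: "('a::topological_space, 'm::finite) chart set \<Rightarrow> 'a \<Rightarrow> ('a \<Rightarrow> real^'m) \<Rightarrow> bool" where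
  "smooth_field_near A p X \<longleftrightarrow> (\<exists>U. p \<in> U \<and> smooth_field_on A U X)"

definition dir_deriv :: "('a, 'm::finite) chart set \<Rightarrow> 'a \<Rightarrow> real^'m \<Rightarrow> ('a \<Rightarrow> real) \<Rightarrow> real" where
  "dir_deriv A p v f =
     frechet_derivative (f \<circ> chart_inv (chart_at A p)) (at (snd (chart_at A p) p)) v"

definition lie_bracket :: "('a::topological_space, 'm::finite) chart set \<Rightarrow>
    ('a \<Rightarrow> real^'m) \<Rightarrow> ('a \<Rightarrow> real^'m) \<Rightarrow> 'a \<Rightarrow> real^'m" where
  "lie_bracket A X Y p = (THE z. \<forall>f. smooth_fun_near A p f \<longrightarrow>
     dir_deriv A p z f = dir_deriv A p (X p) (\<lambda>q. dir_deriv A q (Y q) f)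
                       - dir_deriv A p (Y p) (\<lambda>q. dir_deriv A q (X q) f))"


section \<open>Lorentzian metrics and the Levi-Civita connection\<close>

text \<open>Signature \<open>(-,+,\<dots>,+)\<close>.\<close>

definition lorentzian_form :: "(real^'m::finite \<Rightarrow> real^'m \<Rightarrow> real) \<Rightarrow> bool" where
  "lorentzian_form b \<longleftrightarrow> bilinear b \<and> (\<forall>v w. b v w = b w v) \<and>
     (\<exists>e :: nat \<Rightarrow> real^'m. \<forall>i < CARD('m). \<forall>j < CARD('m).
        b (e i) (e j) = (if i = j then (if i = 0 then - 1 else 1) else 0))"

definition lorentzian_metric :: "('a::topological_space, 'm::finite) chart set \<Rightarrow>
    ('a \<Rightarrow> real^'m \<Rightarrow> real^'m \<Rightarrow> real) \<Rightarrow> bool" where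
  "lorentzian_metric A g \<longleftrightarrow> (\<forall>p. lorentzian_form (g p)) \<and>
     (\<forall>U X Y. smooth_field_on A U X \<and> smooth_field_on A U Y \<longrightarrow>
        smooth_fun_on A U (\<lambda>p. g p (X p) (Y p)))"

text \<open>An affine connection is written as \<open>nabla p v X\<close>, the covariant derivative at \<open>p\<close> of a vector
  field \<open>X\<close>, smooth around \<open>p\<close>, along the tangent vector \<open>v\<close>.\<close>

definition affine_connection :: "('a::topological_space, 'm::finite) chart set \<Rightarrow>
    ('a \<Rightarrow> real^'m \<Rightarrow> ('a \<Rightarrow> real^'m) \<Rightarrow> real^'m) \<Rightarrow> bool" where
  "affine_connection A nabla \<longleftrightarrow>
     (\<forall>p X. smooth_field_near A p X \<longrightarrow> linear (\<lambda>v. nabla p v X)) \<and>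
     (\<forall>p v X Y. smooth_field_near A p X \<and> smooth_field_near A p Y \<longrightarrow>
        nabla p v (\<lambda>q. X q + Y q) = nabla p v X + nabla p v Y) \<and>
     (\<forall>p v f X. smooth_fun_near A p f \<and> smooth_field_near A p X \<longrightarrow>
        nabla p v (\<lambda>q. f q *\<^sub>R X q) = dir_deriv A p v f *\<^sub>R X p + f p *\<^sub>R nabla p v X) \<and>
     (\<forall>U X Y. smooth_field_on A U X \<and> smooth_field_on A U Y \<longrightarrow>
        smooth_field_on A U (\<lambda>p. nabla p (X p) Y))"

definition levi_civita :: "('a::topological_space, 'm::finite) chart set \<Rightarrow>
    ('a \<Rightarrow> real^'m \<Rightarrow> real^'m \<Rightarrow> real) \<Rightarrow>
    ('a \<Rightarrow> real^'m \<Rightarrow> ('a \<Rightarrow> real^'m) \<Rightarrow> real^'m) \<Rightarrow> bool" where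
  "levi_civita A g nabla \<longleftrightarrow> affine_connection A nabla \<and>
     (\<forall>p v X Y. smooth_field_near A p X \<and> smooth_field_near A p Y \<longrightarrow>
        dir_deriv A p v (\<lambda>q. g q (X q) (Y q)) = g p (nabla p v X) (Y p) + g p (X p) (nabla p v Y)) \<and>
     (\<forall>p X Y. smooth_field_near A p X \<and> smooth_field_near A p Y \<longrightarrow>
        nabla p (X p) Y - nabla p (Y p) X = lie_bracket A X Y p)"

definition divergence :: "('a \<Rightarrow> real^'m \<Rightarrow> ('a \<Rightarrow> real^'m) \<Rightarrow> real^'m) \<Rightarrow>
    ('a \<Rightarrow> real^'m::finite) \<Rightarrow> 'a \<Rightarrow> real" where
  "divergence nabla X p = trace (matrix (\<lambda>v. nabla p v X))"

text \<open>The following three tensors are defined at \<open>p\<close> by the usual formulas on vector fields; the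
  value does not depend on the chosen extensions of the tangent vectors to local fields.\<close>

definition cov_deriv_form :: "('a::topological_space, 'm::finite) chart set \<Rightarrow>
    ('a \<Rightarrow> real^'m \<Rightarrow> ('a \<Rightarrow> real^'m) \<Rightarrow> real^'m) \<Rightarrow>
    ('a \<Rightarrow> real^'m \<Rightarrow> real) \<Rightarrow> 'a \<Rightarrow> real^'m \<Rightarrow> real^'m \<Rightarrow> real" where
  "cov_deriv_form A nabla \<omega> p v w = (THE r. \<forall>Y. smooth_field_near A p Y \<and> Y p = w \<longrightarrow>
     r = dir_deriv A p v (\<lambda>q. \<omega> q (Y q)) - \<omega> p (nabla p v Y))"

text \<open>The factor \<open>1/2\<close> is the convention \<open>(d\<omega>)\<^sub>a\<^sub>b = (\<nabla>\<^sub>a \<omega>\<^sub>b - \<nabla>\<^sub>b \<omega>\<^sub>a) / 2\<close>.\<close>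

definition ext_deriv_form :: "('a::topological_space, 'm::finite) chart set \<Rightarrow>
    ('a \<Rightarrow> real^'m \<Rightarrow> real) \<Rightarrow> 'a \<Rightarrow> real^'m \<Rightarrow> real^'m \<Rightarrow> real" where
  "ext_deriv_form A \<omega> p v w = (THE r. \<forall>X Y.
     smooth_field_near A p X \<and> X p = v \<and> smooth_field_near A p Y \<and> Y p = w \<longrightarrow>
     r = (dir_deriv A p v (\<lambda>q. \<omega> q (Y q)) - dir_deriv A p w (\<lambda>q. \<omega> q (X q))
          - \<omega> p (lie_bracket A X Y p)) / 2)"

definition lie_deriv_metric :: "('a::topological_space, 'm::finite) chart set \<Rightarrow>
    ('a \<Rightarrow> real^'m \<Rightarrow> real^'m \<Rightarrow> real) \<Rightarrow> ('a \<Rightarrow> real^'m) \<Rightarrow>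
    'a \<Rightarrow> real^'m \<Rightarrow> real^'m \<Rightarrow> real" where
  "lie_deriv_metric A g k p v w = (THE r. \<forall>X Y.
     smooth_field_near A p X \<and> X p = v \<and> smooth_field_near A p Y \<and> Y p = w \<longrightarrow>
     r = dir_deriv A p (k p) (\<lambda>q. g q (X q) (Y q))
         - g p (lie_bracket A k X p) w - g p v (lie_bracket A k Y p))"


section \<open>Optical geometries\<close>

definition null_line_distribution :: "('a::topological_space, 'm::finite) chart set \<Rightarrow>
    ('a \<Rightarrow> real^'m \<Rightarrow> real^'m \<Rightarrow> real) \<Rightarrow> ('a \<Rightarrow> (real^'m) set) \<Rightarrow> bool" where
  "null_line_distribution A g K \<longleftrightarrow>
     (\<forall>p. \<exists>U k. p \<in> U \<and> smooth_field_on A U k \<and>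
        (\<forall>q\<in>U. k q \<noteq> 0 \<and> K q = span {k q} \<and> g q (k q) (k q) = 0))"

text \<open>A time-orientation is given by a global timelike vector field \<open>t\<close>.\<close>

definition optical_geometry :: "nat \<Rightarrow> ('a::{t2_space,second_countable_topology}, 'm::finite) chart set \<Rightarrow>
    ('a \<Rightarrow> real^'m \<Rightarrow> real^'m \<Rightarrow> real) \<Rightarrow> ('a \<Rightarrow> real^'m) \<Rightarrow> ('a \<Rightarrow> (real^'m) set) \<Rightarrow> bool" where
  "optical_geometry n A g t K \<longleftrightarrow>
     CARD('m) = n + 2 \<and> oriented_smooth_atlas A \<and> lorentzian_metric A g \<and>
     smooth_field_on A UNIV t \<and> (\<forall>p. g p (t p) (t p) < 0) \<and>
     null_line_distribution A g K"

definition generator :: "('a::topological_space, 'm::finite) chart set \<Rightarrow> ('a \<Rightarrow> (real^'m) set) \<Rightarrow>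
    ('a \<Rightarrow> real^'m) \<Rightarrow> bool" where
  "generator A K k \<longleftrightarrow> smooth_field_on A UNIV k \<and> (\<forall>p. k p \<in> K p \<and> k p \<noteq> 0)"

definition geodesic_congruence :: "('a::topological_space, 'm::finite) chart set \<Rightarrow>
    ('a \<Rightarrow> real^'m \<Rightarrow> ('a \<Rightarrow> real^'m) \<Rightarrow> real^'m) \<Rightarrow> ('a \<Rightarrow> (real^'m) set) \<Rightarrow> bool" where
  "geodesic_congruence A nabla K \<longleftrightarrow> (\<forall>k. generator A K k \<longrightarrow> (\<forall>p. nabla p (k p) k \<in> K p))"

definition orth :: "('a \<Rightarrow> real^'m \<Rightarrow> real^'m \<Rightarrow> real) \<Rightarrow> ('a \<Rightarrow> (real^'m) set) \<Rightarrow> 'a \<Rightarrow> (real^'m) set" where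
  "orth g K p = {v. \<forall>l \<in> K p. g p v l = 0}"

definition coset :: "('a \<Rightarrow> (real^'m) set) \<Rightarrow> 'a \<Rightarrow> real^'m \<Rightarrow> (real^'m) set" where
  "coset K p v = {v + l | l. l \<in> K p}"

definition screen :: "('a \<Rightarrow> real^'m \<Rightarrow> real^'m \<Rightarrow> real) \<Rightarrow> ('a \<Rightarrow> (real^'m) set) \<Rightarrow>
    'a \<Rightarrow> (real^'m) set set" where
  "screen g K p = coset K p ` orth g K p"

text \<open>The bilinear form on the screen space induced by a bilinear form \<open>B\<close> on the tangent space; it
  exists when \<open>B v w = 0\<close> for all \<open>v, w\<close> in \<open>K\<^sup>\<bottom>\<close> one of which lies in \<open>K\<close>.\<close>

definition descend :: "(real^'m \<Rightarrow> real^'m \<Rightarrow> real) \<Rightarrow> (real^'m) set \<Rightarrow> (real^'m) set \<Rightarrow> real" where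
  "descend B P Q = (THE r. \<forall>v\<in>P. \<forall>w\<in>Q. r = B v w)"

definition screen_metric :: "('a \<Rightarrow> real^'m \<Rightarrow> real^'m \<Rightarrow> real) \<Rightarrow>
    'a \<Rightarrow> (real^'m) set \<Rightarrow> (real^'m) set \<Rightarrow> real" where
  "screen_metric g p = descend (g p)"


section \<open>Expansion, twist and shear\<close>

text \<open>A section of a bundle \<open>F(1)\<close> is given by its representatives, one for each generator \<open>k\<close>:
  the argument \<open>k\<close> in the definitions below and in those of the next section.\<close>

definition dual_form :: "('a \<Rightarrow> real^'m \<Rightarrow> real^'m \<Rightarrow> real) \<Rightarrow> ('a \<Rightarrow> real^'m) \<Rightarrow> 'a \<Rightarrow> real^'m \<Rightarrow> real" where
  "dual_form g k p v = g p (k p) v"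

definition expansion :: "('a::topological_space, 'm::finite) chart set \<Rightarrow>
    ('a \<Rightarrow> real^'m \<Rightarrow> real^'m \<Rightarrow> real) \<Rightarrow>
    ('a \<Rightarrow> real^'m \<Rightarrow> ('a \<Rightarrow> real^'m) \<Rightarrow> real^'m) \<Rightarrow> ('a \<Rightarrow> real^'m) \<Rightarrow> 'a \<Rightarrow> real" where
  "expansion A g nabla k p = (THE \<epsilon>. \<forall>v. \<epsilon> * dual_form g k p v =
     dual_form g k p v * divergence nabla k p - cov_deriv_form A nabla (dual_form g k) p (k p) v)"

definition twist :: "('a::topological_space, 'm::finite) chart set \<Rightarrow>
    ('a \<Rightarrow> real^'m \<Rightarrow> real^'m \<Rightarrow> real) \<Rightarrow> ('a \<Rightarrow> real^'m) \<Rightarrow>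
    'a \<Rightarrow> (real^'m) set \<Rightarrow> (real^'m) set \<Rightarrow> real" where
  "twist A g k p = descend (ext_deriv_form A (dual_form g k) p)"

definition shear :: "nat \<Rightarrow> ('a::topological_space, 'm::finite) chart set \<Rightarrow>
    ('a \<Rightarrow> real^'m \<Rightarrow> real^'m \<Rightarrow> real) \<Rightarrow>
    ('a \<Rightarrow> real^'m \<Rightarrow> ('a \<Rightarrow> real^'m) \<Rightarrow> real^'m) \<Rightarrow> ('a \<Rightarrow> real^'m) \<Rightarrow>
    'a \<Rightarrow> (real^'m) set \<Rightarrow> (real^'m) set \<Rightarrow> real" where
  "shear n A g nabla k p = descend (\<lambda>v w.
     1 / 2 * lie_deriv_metric A g k p v w - 1 / real n * expansion A g nabla k p * g p v w)"


section \<open>Intrinsic torsion and its projections\<close>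

definition intrinsic_torsion :: "('a::topological_space, 'm::finite) chart set \<Rightarrow>
    ('a \<Rightarrow> real^'m \<Rightarrow> real^'m \<Rightarrow> real) \<Rightarrow>
    ('a \<Rightarrow> real^'m \<Rightarrow> ('a \<Rightarrow> real^'m) \<Rightarrow> real^'m) \<Rightarrow> ('a \<Rightarrow> real^'m) \<Rightarrow>
    'a \<Rightarrow> real^'m \<Rightarrow> (real^'m) set \<Rightarrow> real" where
  "intrinsic_torsion A g nabla k p v Q =
     (THE r. \<forall>w\<in>Q. r = cov_deriv_form A nabla (dual_form g k) p v w)"

text \<open>The class modulo \<open>Ann(K\<^sup>\<bottom>) \<otimes> H\<^sub>K\<^sup>*\<close> of an element \<open>T\<close> of \<open>Ann(K) \<otimes> H\<^sub>K\<^sup>*\<close>, seen in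
  \<open>H\<^sub>K\<^sup>* \<otimes> H\<^sub>K\<^sup>*\<close>: restrict the first slot to \<open>K\<^sup>\<bottom>\<close> (that is, \<open>P\<close> is a class of vectors of \<open>K\<^sup>\<bottom>\<close>) and
  factor through \<open>K\<close>.\<close>

definition graded_class :: "(real^'m \<Rightarrow> (real^'m) set \<Rightarrow> real) \<Rightarrow>
    (real^'m) set \<Rightarrow> (real^'m) set \<Rightarrow> real" where
  "graded_class T P Q = (THE r. \<forall>v\<in>P. r = T v Q)"

text \<open>The trace \<open>h\<^sup>i\<^sup>j B\<^sub>i\<^sub>j\<close>, computed from a frame \<open>e\<close> of the \<open>n\<close>-dimensional screen space and the
  inverse \<open>hinv\<close> of the Gram matrix of \<open>e\<close>. Invertibility of the Gram matrix forces \<open>n\<close> elements of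
  the screen space to be a basis.\<close>

definition screen_trace :: "nat \<Rightarrow> ('a \<Rightarrow> real^'m \<Rightarrow> real^'m \<Rightarrow> real) \<Rightarrow> ('a \<Rightarrow> (real^'m) set) \<Rightarrow> 'a \<Rightarrow>
    ((real^'m) set \<Rightarrow> (real^'m) set \<Rightarrow> real) \<Rightarrow> real" where
  "screen_trace n g K p B = (THE s. \<forall>(e :: nat \<Rightarrow> (real^'m) set) (hinv :: nat \<Rightarrow> nat \<Rightarrow> real).
     (\<forall>i<n. e i \<in> screen g K p) \<and>
     (\<forall>i<n. \<forall>j<n. (\<Sum>l<n. screen_metric g p (e i) (e l) * hinv l j) = (if i = j then 1 else 0)) \<longrightarrow>
     s = (\<Sum>i<n. \<Sum>j<n. hinv i j * B (e i) (e j)))"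

definition proj_alt :: "((real^'m) set \<Rightarrow> (real^'m) set \<Rightarrow> real) \<Rightarrow>
    (real^'m) set \<Rightarrow> (real^'m) set \<Rightarrow> real" where
  "proj_alt B P Q = (B P Q - B Q P) / 2"

definition proj_sym :: "((real^'m) set \<Rightarrow> (real^'m) set \<Rightarrow> real) \<Rightarrow>
    (real^'m) set \<Rightarrow> (real^'m) set \<Rightarrow> real" where
  "proj_sym B P Q = (B P Q + B Q P) / 2"

definition proj_sym_tracefree :: "nat \<Rightarrow> ('a \<Rightarrow> real^'m \<Rightarrow> real^'m \<Rightarrow> real) \<Rightarrow> ('a \<Rightarrow> (real^'m) set) \<Rightarrow>
    'a \<Rightarrow> ((real^'m) set \<Rightarrow> (real^'m) set \<Rightarrow> real) \<Rightarrow> (real^'m) set \<Rightarrow> (real^'m) set \<Rightarrow> real" where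
  "proj_sym_tracefree n g K p B P Q =
     proj_sym B P Q - 1 / real n * screen_trace n g K p (proj_sym B) * screen_metric g p P Q"

end

theory Submission
  imports Defs
begin

text \<open>For a generator \<open>k\<close> let \<open>L v = \<nabla>\<^sub>v k\<close>. Metric compatibility and vanishing torsion give
  \<open>(\<nabla>\<^sub>v \<kappa>) w = g (L v, w)\<close>, and hence \<open>d\<kappa>\<close> and half of \<open>\<L>\<^sub>k g\<close> are its skew and symmetric parts. Since \<open>k\<close>
  is null, \<open>L\<close> takes values in \<open>K\<^sup>\<bottom>\<close>, and since it is geodesic, \<open>L k = c k\<close>; so all these forms descend to
  the screen space. The defining equation of the expansion reads \<open>\<epsilon> = tr L - c\<close>, and completing a
  screen frame by \<open>k\<close> and one transversal vector to a basis shows that \<open>tr L - c\<close> is the trace of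
  the screen form. The defining descriptions of the tensors at a point are non-vacuous because every
  tangent vector extends to a smooth local field.\<close>

section \<open>Extension of tangent vectors to smooth fields\<close>

text \<open>On an open set, agreement on \<open>S\<close> is agreement near each of its points, so
  the derivatives agree as well. This permits replacing \<open>frechet_derivative\<close> of a
  compound map by an explicit formula in the inductions below.\<close>

lemma Ck_on_cong:
  assumes "open S" "\<And>x. x \<in> S \<Longrightarrow> f x = g x" "Ck_on k S f"
  shows "Ck_on k S g"
  using assms(2,3)
proof (induction k arbitrary: f g)
  case 0
  then show ?case by (metis Ck_on.simps(1) continuous_on_cong)
next
  case (Suc k)
  have der: "(f has_derivative D) (at x) \<longleftrightarrow> (g has_derivative D) (at x)" if "x \<in> S" for x D
    using has_derivative_transform_within_open[of f D x UNIV S g]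
      has_derivative_transform_within_open[of g D x UNIV S f] Suc.prems(1) assms(1) that
    by fastforce
  have "g differentiable at x" if "x \<in> S" for x
    using Suc.prems(2) der[OF that] that unfolding Ck_on.simps differentiable_def by metis
  moreover have "Ck_on k S (\<lambda>x. frechet_derivative g (at x) v)" for v
  proof (rule Suc.IH)
    show "frechet_derivative f (at x) v = frechet_derivative g (at x) v" if "x \<in> S" for x
      by (simp add: frechet_derivative_def der[OF that])
    show "Ck_on k S (\<lambda>x. frechet_derivative f (at x) v)"
      using Suc.prems(2) by simp
  qed
  ultimately show ?case by simp
qed

lemma Ck_on_Suc_imp: "Ck_on (Suc k) S f \<Longrightarrow> Ck_on k S f"
proof (induction k arbitrary: f)
  case 0
  then show ?case
    by (auto intro!: continuous_at_imp_continuous_on differentiable_imp_continuous_within)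
next
  case (Suc k)
  then show ?case by (metis Ck_on.simps(2))
qed

lemma Ck_on_const: "Ck_on k S (\<lambda>x. c)"
  by (induction k arbitrary: c) auto

lemma Ck_on_add:
  assumes "open S" "Ck_on k S f" "Ck_on k S g"
  shows "Ck_on k S (\<lambda>x. f x + g x)"
  using assms(2,3)
proof (induction k arbitrary: f g)
  case 0
  then show ?case by (simp add: continuous_on_add)
next
  case (Suc k)
  have "Ck_on k S (\<lambda>x. frechet_derivative (\<lambda>x. f x + g x) (at x) v)" for v
  proof (rule Ck_on_cong[OF assms(1)])
    show "frechet_derivative f (at x) v + frechet_derivative g (at x) v
        = frechet_derivative (\<lambda>x. f x + g x) (at x) v" if "x \<in> S" for x
    proof -
      have "((\<lambda>x. f x + g x) has_derivative
          (\<lambda>v. frechet_derivative f (at x) v + frechet_derivative g (at x) v)) (at x)"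
        using Suc.prems that by (intro has_derivative_add) (auto simp flip: frechet_derivative_works)
      from fun_cong[OF frechet_derivative_at[OF this]] show ?thesis .
    qed
    show "Ck_on k S (\<lambda>x. frechet_derivative f (at x) v + frechet_derivative g (at x) v)"
      using Suc.prems by (intro Suc.IH) auto
  qed
  then show ?case using Suc.prems by (auto intro!: differentiable_add)
qed

lemma Ck_on_sum:
  assumes "open S" "finite I" "\<And>i. i \<in> I \<Longrightarrow> Ck_on k S (f i)"
  shows "Ck_on k S (\<lambda>x. \<Sum>i\<in>I. f i x)"
  using assms(2,3)
  by (induction I rule: finite_induct) (auto intro: Ck_on_const Ck_on_add[OF assms(1)])

text \<open>By the Leibniz rule each summand of the derivative has one differentiated factor; the
  other one is only needed one class lower, and the induction applies to both products.\<close>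

lemma Ck_on_scaleR:
  fixes a :: "'e::real_normed_vector \<Rightarrow> real"
  assumes "open S" "Ck_on k S a" "Ck_on k S f"
  shows "Ck_on k S (\<lambda>x. a x *\<^sub>R f x)"
  using assms(2,3)
proof (induction k arbitrary: a f)
  case 0
  then show ?case by (simp add: continuous_on_scaleR)
next
  case (Suc k)
  have der: "((\<lambda>x. a x *\<^sub>R f x) has_derivative
      (\<lambda>v. a x *\<^sub>R frechet_derivative f (at x) v + frechet_derivative a (at x) v *\<^sub>R f x)) (at x)"
    if "x \<in> S" for x
    using Suc.prems that by (intro has_derivative_scaleR) (auto simp flip: frechet_derivative_works)
  have "Ck_on k S (\<lambda>x. frechet_derivative (\<lambda>x. a x *\<^sub>R f x) (at x) v)" for v
  proof (rule Ck_on_cong[OF assms(1)])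
    show "a x *\<^sub>R frechet_derivative f (at x) v + frechet_derivative a (at x) v *\<^sub>R f x
        = frechet_derivative (\<lambda>x. a x *\<^sub>R f x) (at x) v" if "x \<in> S" for x
      by (rule fun_cong[OF frechet_derivative_at[OF der[OF that]]])
    show "Ck_on k S (\<lambda>x. a x *\<^sub>R frechet_derivative f (at x) v
        + frechet_derivative a (at x) v *\<^sub>R f x)"
      using Suc.prems by (intro Ck_on_add[OF assms(1)] Suc.IH) (auto intro: Ck_on_Suc_imp)
  qed
  then show ?case using der by (auto simp: differentiable_def)
qed

lemma Ck_on_bounded_linear:
  assumes "open S" "bounded_linear h" "Ck_on k S f"
  shows "Ck_on k S (\<lambda>x. h (f x))"
  using assms(3)
proof (induction k arbitrary: f)
  case 0
  then show ?case by (simp add: bounded_linear.continuous_on[OF assms(2)])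
next
  case (Suc k)
  have der: "((\<lambda>x. h (f x)) has_derivative (\<lambda>v. h (frechet_derivative f (at x) v))) (at x)"
    if "x \<in> S" for x
    using Suc.prems that
    by (intro bounded_linear.has_derivative[OF assms(2)]) (auto simp flip: frechet_derivative_works)
  have "Ck_on k S (\<lambda>x. frechet_derivative (\<lambda>x. h (f x)) (at x) v)" for v
  proof (rule Ck_on_cong[OF assms(1)])
    show "h (frechet_derivative f (at x) v) = frechet_derivative (\<lambda>x. h (f x)) (at x) v"
      if "x \<in> S" for x
      by (rule fun_cong[OF frechet_derivative_at[OF der[OF that]]])
    show "Ck_on k S (\<lambda>x. h (frechet_derivative f (at x) v))"
      using Suc.prems by (intro Suc.IH) auto
  qed
  then show ?case using der by (auto simp: differentiable_def)
qed

text \<open>The chain rule differentiates \<open>f\<close> in a direction that moves with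
  \<open>x\<close>, while \<open>Ck_on\<close> speaks of fixed directions. Expanding the moving
  direction in \<open>Basis\<close> leaves products of scalar functions with fixed-direction
  derivatives of \<open>f\<close>, to which the induction hypothesis applies.\<close>

lemma Ck_on_compose:
  fixes f :: "'e::euclidean_space \<Rightarrow> 'f::real_normed_vector"
    and g :: "'d::real_normed_vector \<Rightarrow> 'e"
  assumes "open S" "g ` S \<subseteq> T" "Ck_on k T f" "Ck_on k S g"
  shows "Ck_on k S (\<lambda>x. f (g x))"
  using assms(3,4)
proof (induction k arbitrary: f)
  case 0
  then show ?case using assms(2) by (auto intro: continuous_on_compose2)
next
  case (Suc k)
  have df: "(f has_derivative frechet_derivative f (at (g x))) (at (g x))" if "x \<in> S" for x
    using Suc.prems assms(2) that by (auto simp flip: frechet_derivative_works)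
  have dg: "(g has_derivative frechet_derivative g (at x)) (at x)" if "x \<in> S" for x
    using Suc.prems that by (auto simp flip: frechet_derivative_works)
  have der: "((\<lambda>x. f (g x)) has_derivative
      (\<lambda>v. frechet_derivative f (at (g x)) (frechet_derivative g (at x) v))) (at x)"
    if "x \<in> S" for x
    using diff_chain_at[OF dg[OF that] df[OF that]] by (simp add: o_def)
  have "Ck_on k S (\<lambda>x. frechet_derivative (\<lambda>x. f (g x)) (at x) v)" for v
  proof (rule Ck_on_cong[OF assms(1)])
    show "(\<Sum>b\<in>Basis. (frechet_derivative g (at x) v \<bullet> b) *\<^sub>R frechet_derivative f (at (g x)) b)
        = frechet_derivative (\<lambda>x. f (g x)) (at x) v" if "x \<in> S" for x
    proof -
      have lin: "linear (frechet_derivative f (at (g x)))"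
        using df[OF that] by (rule has_derivative_linear)
      have "frechet_derivative (\<lambda>x. f (g x)) (at x) v
          = frechet_derivative f (at (g x)) (frechet_derivative g (at x) v)"
        using frechet_derivative_at[OF der[OF that]] by metis
      also have "\<dots> = frechet_derivative f (at (g x))
          (\<Sum>b\<in>Basis. (frechet_derivative g (at x) v \<bullet> b) *\<^sub>R b)"
        by (simp add: euclidean_representation)
      also have "\<dots> = (\<Sum>b\<in>Basis. (frechet_derivative g (at x) v \<bullet> b) *\<^sub>R
          frechet_derivative f (at (g x)) b)"
        by (simp add: linear_sum[OF lin] linear_cmul[OF lin])
      finally show ?thesis by simp
    qed
    show "Ck_on k S (\<lambda>x. \<Sum>b\<in>Basis. (frechet_derivative g (at x) v \<bullet> b) *\<^sub>R
        frechet_derivative f (at (g x)) b)"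
      using Suc.prems Ck_on_Suc_imp[OF Suc.prems(2)]
      by (intro Ck_on_sum Ck_on_scaleR Ck_on_bounded_linear[OF assms(1) bounded_linear_inner_left]
          Suc.IH assms(1)) auto
  qed
  then show ?case using der by (auto simp: differentiable_def)
qed

section \<open>Charts and transition maps\<close>

lemma chart_inv_left: "x \<in> fst c \<Longrightarrow> is_chart c \<Longrightarrow> chart_inv c (snd c x) = x"
  by (auto simp: is_chart_def homeomorphism_def)

lemma open_chart_image:
  assumes "is_chart c" "open U"
  shows "open (snd c ` (fst c \<inter> U))"
proof -
  have h: "open (snd c ` fst c)" "continuous_on (snd c ` fst c) (chart_inv c)"
    using assms(1) by (auto simp: is_chart_def homeomorphism_def)
  have "snd c ` (fst c \<inter> U) = snd c ` fst c \<inter> chart_inv c -` U"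
    using chart_inv_left[OF _ assms(1)] by auto
  then show ?thesis using continuous_open_preimage[OF h(2,1) assms(2)] by simp
qed

lemma chart_at_atlas:
  assumes "oriented_smooth_atlas A"
  shows "chart_at A p \<in> A" "p \<in> fst (chart_at A p)"
proof -
  have "\<exists>c. c \<in> A \<and> p \<in> fst c"
    using assms unfolding oriented_smooth_atlas_def by blast
  from someI_ex[OF this] show "chart_at A p \<in> A" "p \<in> fst (chart_at A p)"
    by (auto simp: chart_at_def)
qed

lemma transition_has_derivative:
  assumes "oriented_smooth_atlas A" "c \<in> A" "d \<in> A" "q \<in> fst c" "q \<in> fst d"
  shows "(transition c d has_derivative frechet_derivative (transition c d) (at (snd c q)))
           (at (snd c q))"
proof -
  have "smooth_on (snd c ` (fst c \<inter> fst d)) (transition c d)"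
    using assms by (auto simp: oriented_smooth_atlas_def)
  then have "Ck_on (Suc 0) (snd c ` (fst c \<inter> fst d)) (transition c d)"
    unfolding smooth_on_def by blast
  then show ?thesis using assms(4,5) by (auto simp flip: frechet_derivative_works)
qed

text \<open>Chain rule for the composite of two transition maps, which equals the direct one on the
  chart image of the overlap of \<open>b\<close> and \<open>c\<close>. It makes the components of a
  tangent vector consistent between charts.\<close>

lemma transition_cocycle:
  assumes "oriented_smooth_atlas A" "b \<in> A" "c \<in> A" "d \<in> A" "q \<in> fst b" "q \<in> fst c" "q \<in> fst d"
  shows "frechet_derivative (transition c d) (at (snd c q))
           (frechet_derivative (transition b c) (at (snd b q)) v)
         = frechet_derivative (transition b d) (at (snd b q)) v"
proof -
  have charts: "is_chart b" "is_chart c" and "open (fst c)"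
    using assms by (auto simp: oriented_smooth_atlas_def is_chart_def)
  have eq: "transition b c (snd b q) = snd c q"
    using chart_inv_left[OF assms(5) charts(1)] by (simp add: transition_def)
  have "(transition c d has_derivative frechet_derivative (transition c d) (at (snd c q)))
      (at (transition b c (snd b q)))"
    using transition_has_derivative[OF assms(1,3,4,6,7)] by (simp add: eq)
  from diff_chain_at[OF transition_has_derivative[OF assms(1,2,3,5,6)] this]
  have "(transition b d has_derivative (frechet_derivative (transition c d) (at (snd c q))
      \<circ> frechet_derivative (transition b c) (at (snd b q)))) (at (snd b q))"
  proof (rule has_derivative_transform_within_open)
    show "open (snd b ` (fst b \<inter> fst c))"
      by (rule open_chart_image) fact+
    show "snd b q \<in> snd b ` (fst b \<inter> fst c)" using assms by auto
    show "(transition c d \<circ> transition b c) x = transition b d x"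
      if "x \<in> snd b ` (fst b \<inter> fst c)" for x
      using that chart_inv_left[OF _ charts(1)] chart_inv_left[OF _ charts(2)]
      by (auto simp: transition_def)
  qed
  from frechet_derivative_at[OF this] show ?thesis by (metis comp_apply)
qed

text \<open>The extension has constant components in the chosen chart at \<open>p\<close>.\<close>

lemma smooth_field_extension:
  assumes "oriented_smooth_atlas A"
  obtains Y where "smooth_field_near A p Y" "Y p = w"
proof -
  define b where "b = chart_at A p"
  have b: "b \<in> A" "p \<in> fst b" using chart_at_atlas[OF assms] by (auto simp: b_def)
  have chart: "is_chart c" if "c \<in> A" for c
    using assms that by (auto simp: oriented_smooth_atlas_def)
  have op: "open (fst c)" if "c \<in> A" for c using chart[OF that] by (simp add: is_chart_def)
  have smooth: "smooth_on (snd c ` (fst c \<inter> fst d)) (transition c d)" if "c \<in> A" "d \<in> A" for c d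
    using assms that by (auto simp: oriented_smooth_atlas_def)
  \<comment> \<open>A field lists its components in the chart chosen at each point, so the constant
    vector \<open>w\<close> is carried from \<open>b\<close> to that chart. Values outside the
    domain of \<open>b\<close> are irrelevant.\<close>
  define Y where "Y q = frechet_derivative (transition b (chart_at A q)) (at (snd b q)) w" for q
  have "smooth_on (snd c ` (fst c \<inter> fst b))
      (\<lambda>x. vec_coords A c (chart_inv c x) (Y (chart_inv c x)))" if c: "c \<in> A" for c
    unfolding smooth_on_def
  proof
    fix k
    let ?S = "snd c ` (fst c \<inter> fst b)" and ?T = "snd b ` (fst b \<inter> fst c)"
    have S: "open ?S" by (intro open_chart_image chart op c b)
    show "Ck_on k ?S (\<lambda>x. vec_coords A c (chart_inv c x) (Y (chart_inv c x)))"
    proof (rule Ck_on_cong[OF S])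
      \<comment> \<open>By the cocycle rule the possibly jumping chart chosen at \<open>q\<close>
        cancels; only the Jacobian from \<open>b\<close> to \<open>c\<close> remains.\<close>
      show "frechet_derivative (transition b c) (at (transition c b x)) w
          = vec_coords A c (chart_inv c x) (Y (chart_inv c x))" if x: "x \<in> ?S" for x
      proof -
        obtain q where q: "q \<in> fst c" "q \<in> fst b" "x = snd c q" using x by blast
        then show ?thesis
          using transition_cocycle[OF assms b(1) chart_at_atlas(1)[OF assms] c q(2)
              chart_at_atlas(2)[OF assms] q(1)] chart_inv_left[OF q(1) chart[OF c]]
          by (simp add: vec_coords_def Y_def transition_def)
      qed
      \<comment> \<open>The components are first derivatives of a transition map, which costs one
        order of differentiability.\<close>
      have "Ck_on (Suc k) ?T (transition b c)"
        using smooth[OF b(1) c] unfolding smooth_on_def by blast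
      then have "Ck_on k ?T (\<lambda>y. frechet_derivative (transition b c) (at y) w)" by simp
      moreover have "Ck_on k ?S (transition c b)"
        using smooth[OF c b(1)] unfolding smooth_on_def by blast
      moreover have "transition c b ` ?S \<subseteq> ?T"
        using chart_inv_left[OF _ chart[OF c]] by (auto simp: transition_def)
      ultimately show "Ck_on k ?S (\<lambda>x. frechet_derivative (transition b c) (at (transition c b x)) w)"
        using Ck_on_compose[OF S] by blast
    qed
  qed
  then have "smooth_field_near A p Y"
    using b op[OF b(1)] by (auto simp: smooth_field_near_def smooth_field_on_def)
  moreover have "Y p = w"
  proof -
    have "((\<lambda>x. x) has_derivative (\<lambda>x. x)) (at (snd b p))" by simp
    then have "(transition b b has_derivative (\<lambda>x. x)) (at (snd b p))"
    proof (rule has_derivative_transform_within_open)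
      show "open (snd b ` fst b)" using chart[OF b(1)] by (simp add: is_chart_def)
      show "snd b p \<in> snd b ` fst b" using b by auto
      show "x = transition b b x" if "x \<in> snd b ` fst b" for x
        using that chart_inv_left[OF _ chart[OF b(1)]] by (auto simp: transition_def)
    qed
    from frechet_derivative_at[OF this] show ?thesis
      unfolding Y_def by (metis b_def)
  qed
  ultimately show thesis by (rule that)
qed

section \<open>Linear algebra of a null vector\<close>

text \<open>Applying \<open>\<phi> i\<close> to a linear relation isolates the coefficient of
  \<open>b i\<close>, so the family is independent and, by its cardinality, spans. The expansion map
  and the identity agree on this spanning set.\<close>

lemma biorthogonal_expansion:
  fixes b :: "'i \<Rightarrow> real^'m"
  assumes I: "finite I" "card I = CARD('m)"
    and lin: "\<And>i. i \<in> I \<Longrightarrow> linear (\<phi> i)"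
    and dual: "\<And>i j. i \<in> I \<Longrightarrow> j \<in> I \<Longrightarrow> \<phi> i (b j) = (if i = j then 1 else 0 :: real)"
  shows "(\<Sum>i\<in>I. \<phi> i x *\<^sub>R b i) = x"
proof -
  have inj: "inj_on b I"
    by (rule inj_onI) (metis dual zero_neq_one)
  have "independent (b ` I)"
  proof (subst independent_explicit_finite_subsets, intro allI impI ballI)
    fix T u w
    assume T: "T \<subseteq> b ` I" "finite T" and 0: "(\<Sum>w\<in>T. u w *\<^sub>R w) = 0" and w: "w \<in> T"
    obtain i where i: "i \<in> I" "w = b i" using w T by auto
    have "u w' * \<phi> i w' = (if w' = w then u w else 0)" if w': "w' \<in> T" for w'
    proof -
      obtain j where "j \<in> I" "w' = b j" using w' T by blast
      then show ?thesis using dual[OF i(1), of j] i inj by (auto simp: inj_on_def)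
    qed
    then have "(\<Sum>w'\<in>T. u w' * \<phi> i w') = (\<Sum>w'\<in>T. if w' = w then u w else 0)"
      by (rule sum.cong[OF refl])
    also have "\<dots> = u w" using w T by simp
    also have "(\<Sum>w'\<in>T. u w' * \<phi> i w') = \<phi> i (\<Sum>w\<in>T. u w *\<^sub>R w)"
      by (simp add: linear_sum[OF lin[OF i(1)]] linear_cmul[OF lin[OF i(1)]])
    finally show "u w = 0" using 0 linear_0[OF lin[OF i(1)]] by simp
  qed
  then have span: "UNIV \<subseteq> span (b ` I)"
    using I by (intro card_ge_dim_independent) (auto simp: card_image[OF inj])
  have "linear (\<lambda>x. \<Sum>i\<in>I. \<phi> i x *\<^sub>R b i)"
    by (rule linearI) (simp_all add: linear_add[OF lin] linear_cmul[OF lin] algebra_simps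
        sum.distrib scaleR_sum_right cong: sum.cong)
  moreover have "linear (\<lambda>x :: real^'m. x)" by (simp add: linear_ident)
  ultimately show ?thesis
  proof (rule linear_eq_on[where B = "b ` I"])
    show "x \<in> span (b ` I)" using span by auto
    fix w assume "w \<in> b ` I"
    then obtain j where j: "j \<in> I" "w = b j" by auto
    have "(\<Sum>i\<in>I. \<phi> i w *\<^sub>R b i) = (\<Sum>i\<in>I. if i = j then b i else 0)"
      using j dual by (intro sum.cong) auto
    then show "(\<Sum>i\<in>I. \<phi> i w *\<^sub>R b i) = w" using I j by simp
  qed
qed

text \<open>Expand the standard basis vectors in the family \<open>b\<close>, exchange the sums, and
  let \<open>\<phi> i\<close> reassemble \<open>L (b i)\<close> from its coordinates.\<close>

lemma trace_biorthogonal: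
  fixes b :: "'i \<Rightarrow> real^'m" and L :: "real^'m \<Rightarrow> real^'m"
  assumes I: "finite I" "card I = CARD('m)"
    and lin: "\<And>i. i \<in> I \<Longrightarrow> linear (\<phi> i)"
    and dual: "\<And>i j. i \<in> I \<Longrightarrow> j \<in> I \<Longrightarrow> \<phi> i (b j) = (if i = j then 1 else 0 :: real)"
    and L: "linear L"
  shows "trace (matrix L) = (\<Sum>i\<in>I. \<phi> i (L (b i)))"
proof -
  have "trace (matrix L) = (\<Sum>l\<in>UNIV. L (axis l 1) $ l)"
    by (simp add: trace_def matrix_def)
  also have "\<dots> = (\<Sum>l\<in>UNIV. \<Sum>i\<in>I. \<phi> i (axis l 1) * L (b i) $ l)"
  proof (rule sum.cong[OF refl])
    fix l :: 'm
    have "L (axis l 1) = L (\<Sum>i\<in>I. \<phi> i (axis l 1) *\<^sub>R b i)"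
      using biorthogonal_expansion[OF I lin dual] by metis
    then show "L (axis l 1) $ l = (\<Sum>i\<in>I. \<phi> i (axis l 1) * L (b i) $ l)"
      by (simp add: linear_sum[OF L] linear_cmul[OF L])
  qed
  also have "\<dots> = (\<Sum>i\<in>I. \<Sum>l\<in>UNIV. \<phi> i (axis l 1) * L (b i) $ l)"
    by (rule sum.swap)
  also have "\<dots> = (\<Sum>i\<in>I. \<phi> i (L (b i)))"
  proof (rule sum.cong[OF refl])
    fix i assume i: "i \<in> I"
    have "\<phi> i (L (b i)) = \<phi> i (\<Sum>l\<in>UNIV. L (b i) $ l *\<^sub>R axis l 1)"
      using basis_expansion[of "L (b i)"] by (simp add: scalar_mult_eq_scaleR)
    then show "(\<Sum>l\<in>UNIV. \<phi> i (axis l 1) * L (b i) $ l) = \<phi> i (L (b i))"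
      by (simp add: linear_sum[OF lin[OF i]] linear_cmul[OF lin[OF i]] mult.commute)
  qed
  finally show ?thesis .
qed

section \<open>Lorentzian forms and frames orthogonal to a vector\<close>

lemma lorentzian_nondegenerate:
  fixes b :: "real^'m \<Rightarrow> real^'m \<Rightarrow> real"
  assumes b: "lorentzian_form b" and 0: "\<And>w. b v w = 0"
  shows "v = 0"
proof -
  obtain e where e: "\<And>i j. i < CARD('m) \<Longrightarrow> j < CARD('m) \<Longrightarrow>
      b (e i) (e j) = (if i = j then (if i = 0 then - 1 else 1) else 0)"
    using b unfolding lorentzian_form_def by blast
  have bl: "linear (\<lambda>x. b x y)" for y using b by (auto simp: lorentzian_form_def bilinear_def)
  \<comment> \<open>The sign at \<open>i = 0\<close> compensates \<open>b (e 0) (e 0) = - 1\<close>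
    and turns pairing with the frame into the dual family.\<close>
  have "(\<Sum>i<CARD('m). ((if i = 0 then - 1 else 1) * b v (e i)) *\<^sub>R e i) = v"
  proof (rule biorthogonal_expansion)
    show "linear (\<lambda>x. (if i = 0 then - 1 else 1) * b x (e i))" for i :: nat
      by (rule linearI) (auto simp: linear_add[OF bl] linear_cmul[OF bl])
  qed (use e in auto)
  then show ?thesis by (simp add: 0)
qed

text \<open>On the span of the spacelike frame vectors the form is Euclidean, and orthogonality to
  \<open>k\<close> is one further linear condition there. At least \<open>n\<close> dimensions
  survive, in which a Euclidean orthonormal basis can be chosen.\<close>

lemma orthonormal_screen_frame:
  fixes b :: "real^'m \<Rightarrow> real^'m \<Rightarrow> real"
  assumes b: "lorentzian_form b" and dim: "CARD('m) = n + 2"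
  obtains v :: "nat \<Rightarrow> real^'m" where "\<And>i. i < n \<Longrightarrow> b k (v i) = 0"
    "\<And>i j. i < n \<Longrightarrow> j < n \<Longrightarrow> b (v i) (v j) = (if i = j then 1 else 0)"
proof -
  obtain e where e: "\<And>i j. i < CARD('m) \<Longrightarrow> j < CARD('m) \<Longrightarrow>
      b (e i) (e j) = (if i = j then (if i = 0 then - 1 else 1) else 0)"
    using b unfolding lorentzian_form_def by blast
  have bl: "linear (\<lambda>x. b x y)" and br: "linear (b y)" for y
    using b by (auto simp: lorentzian_form_def bilinear_def)
  obtain f :: "'m \<Rightarrow> nat" where f: "bij_betw f UNIV {0..<CARD('m)}"
    using ex_bij_betw_finite_nat[of "UNIV :: 'm set"] by auto
  have f_less: "f j < CARD('m)" for j using f by (auto simp: bij_betw_def)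
  have f_eq: "f i = f j \<longleftrightarrow> i = j" for i j using f by (auto simp: bij_betw_def inj_on_def)
  obtain j0 where j0: "f j0 = 0"
    using f dim by (metis UNIV_I atLeastLessThan_iff bij_betw_iff_bijections le0 zero_less_card_finite)
  \<comment> \<open>\<open>J\<close> turns coordinates into vectors of the Lorentzian frame, and
    \<open>c\<close> represents the functional \<open>b k\<close> in these coordinates.\<close>
  define J where "J x = (\<Sum>j\<in>UNIV. x $ j *\<^sub>R e (f j))" for x :: "real^'m"
  define c :: "real^'m" where "c = (\<chi> j. b k (e (f j)))"
  have bJ: "b y (J x) = (\<Sum>j\<in>UNIV. x $ j * b y (e (f j)))" for x y
    by (simp add: J_def linear_sum[OF br] linear_cmul[OF br])
  have bJ': "b (J x) y = (\<Sum>j\<in>UNIV. x $ j * b (e (f j)) y)" for x y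
    by (simp add: J_def linear_sum[OF bl] linear_cmul[OF bl])
  have J_k: "b k (J x) = x \<bullet> c" for x
    by (simp add: bJ c_def inner_vec_def)
  \<comment> \<open>The only minus sign sits at the index \<open>j0\<close>, so it disappears as
    soon as one argument has no component there.\<close>
  have J_J: "b (J x) (J y) = x \<bullet> y" if "x $ j0 = 0" for x y
  proof -
    have "b (J x) (J y) = (\<Sum>j\<in>UNIV. x $ j * (\<Sum>l\<in>UNIV. y $ l * b (e (f j)) (e (f l))))"
      by (subst bJ') (simp add: bJ)
    also have "\<dots> = (\<Sum>j\<in>UNIV. x $ j * y $ j)"
    proof (rule sum.cong[OF refl])
      fix j
      have "(\<Sum>l\<in>UNIV. y $ l * b (e (f j)) (e (f l)))
          = (\<Sum>l\<in>UNIV. if l = j then y $ j * (if f j = 0 then - 1 else 1) else 0)"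
        by (rule sum.cong) (auto simp: e[OF f_less f_less] f_eq)
      also have "\<dots> = y $ j * (if f j = 0 then - 1 else 1)" by simp
      finally show "x $ j * (\<Sum>l\<in>UNIV. y $ l * b (e (f j)) (e (f l))) = x $ j * y $ j"
        using that f_eq[of j j0] j0 by auto
    qed
    finally show ?thesis by (simp add: inner_vec_def)
  qed
  \<comment> \<open>The two conditions, no timelike component and orthogonality to \<open>k\<close>,
    may be dependent. Hence only a lower bound for \<open>dim S\<close> is available, and
    \<open>n\<close> members of its basis are selected.\<close>
  let ?A = "span {axis j0 1, c}"
  define S where "S = {y \<in> UNIV. \<forall>x \<in> ?A. orthogonal x y}"
  have "dim S + dim ?A = n + 2"
    using dim_subspace_orthogonal_to_vectors[of ?A UNIV] dim by (simp add: S_def)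
  moreover have "dim ?A \<le> 2"
    using dim_le_card'[of "{axis j0 1, c}"] by (simp add: card_insert_if split: if_splits)
  ultimately have "n \<le> dim S" by simp
  have "subspace S"
    unfolding S_def using subspace_orthogonal_to_vectors[of ?A] by simp
  then obtain B where B: "B \<subseteq> S" "pairwise orthogonal B" "\<And>x. x \<in> B \<Longrightarrow> norm x = 1"
      "independent B" "card B = dim S"
    using orthonormal_basis_subspace by metis
  have "finite B" using B(4) independent_imp_finite by blast
  then obtain h where h: "bij_betw h {0..<card B} B"
    using ex_bij_betw_nat_finite by blast
  have hB: "h i \<in> B" if "i < n" for i
    using h \<open>n \<le> dim S\<close> B(5) that by (auto simp: bij_betw_def)
  have h_inj: "h i = h j \<longleftrightarrow> i = j" if "i < n" "j < n" for i j
    using h \<open>n \<le> dim S\<close> B(5) that by (auto simp: bij_betw_def inj_on_def)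
  have h_S: "h i \<bullet> axis j0 1 = 0" "h i \<bullet> c = 0" if "i < n" for i
  proof -
    have "\<forall>x \<in> ?A. orthogonal x (h i)" using hB[OF that] B(1) by (auto simp: S_def)
    then have "orthogonal (axis j0 1) (h i)" "orthogonal c (h i)"
      by (meson insertI1 insertI2 span_base)+
    then show "h i \<bullet> axis j0 1 = 0" "h i \<bullet> c = 0"
      by (simp_all add: orthogonal_def inner_commute)
  qed
  show thesis
  proof
    show "b k (J (h i)) = 0" if "i < n" for i
      using h_S[OF that] by (simp add: J_k)
    show "b (J (h i)) (J (h j)) = (if i = j then 1 else 0)" if "i < n" "j < n" for i j
    proof -
      have "b (J (h i)) (J (h j)) = h i \<bullet> h j"
        using h_S(1)[OF that(1)] by (intro J_J) (simp add: inner_axis)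
      then show ?thesis
        using B(2) B(3)[OF hB[OF that(1)]] hB[OF that(1)] hB[OF that(2)] h_inj[OF that]
        by (auto simp: pairwise_def orthogonal_def norm_eq_1)
    qed
  qed
qed

text \<open>With \<open>H'\<close> the transpose of \<open>H\<close>, the product
  \<open>H' G H\<close> equals \<open>H'\<close> because \<open>G H\<close> is the identity, and
  equals \<open>H\<close> because \<open>H' G\<close> is the transpose of
  \<open>G H\<close>.\<close>

lemma symmetric_right_inverse:
  fixes G H :: "nat \<Rightarrow> nat \<Rightarrow> real"
  assumes sym: "\<And>i j. i < n \<Longrightarrow> j < n \<Longrightarrow> G i j = G j i"
    and inv: "\<And>i j. i < n \<Longrightarrow> j < n \<Longrightarrow> (\<Sum>l<n. G i l * H l j) = (if i = j then 1 else 0)"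
    and ij: "i < n" "j < n"
  shows "H i j = H j i"
proof -
  have "H j i = (\<Sum>l<n. H l i * (if l = j then 1 else 0))"
    using ij by (simp add: if_distrib[of "(*) _"] cong: if_cong)
  also have "\<dots> = (\<Sum>l<n. H l i * (\<Sum>m<n. G l m * H m j))"
    using ij inv by (intro sum.cong) auto
  also have "\<dots> = (\<Sum>m<n. \<Sum>l<n. H l i * (G l m * H m j))"
    by (subst sum.swap) (simp add: sum_distrib_left)
  also have "\<dots> = (\<Sum>m<n. (\<Sum>l<n. G m l * H l i) * H m j)"
    using sym by (auto intro!: sum.cong simp: sum_distrib_right)
  also have "\<dots> = (\<Sum>m<n. (if m = i then 1 else 0) * H m j)"
    using ij inv by (intro sum.cong) auto
  also have "\<dots> = (\<Sum>m<n. if m = i then H m j else 0)"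
    by (intro sum.cong) auto
  also have "\<dots> = H i j" using ij by simp
  finally show ?thesis by simp
qed

text \<open>Complete \<open>k\<close> and the frame to a basis by any \<open>M\<close> with \<open>b M k = 1\<close>. The image of \<open>L\<close> being
  orthogonal to \<open>k\<close>, the basis vector \<open>M\<close> contributes nothing to the trace.\<close>

lemma trace_null_frame:
  fixes b :: "real^'m \<Rightarrow> real^'m \<Rightarrow> real" and v :: "nat \<Rightarrow> real^'m"
  assumes b: "lorentzian_form b" and dim: "CARD('m) = n + 2"
    and k: "k \<noteq> 0" "b k k = 0"
    and L: "linear L" "L k = c *\<^sub>R k" "\<And>x. b (L x) k = 0"
    and v: "\<And>i. i < n \<Longrightarrow> b (v i) k = 0"
    and inv: "\<And>i j. i < n \<Longrightarrow> j < n \<Longrightarrow> (\<Sum>l<n. b (v i) (v l) * H l j) = (if i = j then 1 else 0)"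
  shows "trace (matrix L) = c + (\<Sum>i<n. \<Sum>j<n. H i j * b (L (v i)) (v j))"
proof -
  have sym: "b x y = b y x" and bl: "linear (\<lambda>x. b x y)" and br: "linear (b y)" for x y
    using b by (auto simp: lorentzian_form_def bilinear_def)
  note lin = linear_add[OF bl] linear_diff[OF bl] linear_cmul[OF bl] linear_0[OF bl]
  \<comment> \<open>Nondegeneracy supplies a vector not orthogonal to \<open>k\<close>, which is
    then rescaled.\<close>
  obtain M0 where "b M0 k \<noteq> 0" using lorentzian_nondegenerate[OF b, of k] k(1) sym by metis
  then obtain M where M: "b M k = 1"
    by (metis divide_self_if lin(3) real_scaleR_def divide_inverse mult.commute)
  define \<psi> where "\<psi> i y = (\<Sum>j<n. b y (v j) * H j i)" for i y
  define P where "P x = x - b x k *\<^sub>R M" for x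
  \<comment> \<open>The dual family: \<open>P\<close> removes the component along \<open>M\<close>,
    \<open>\<psi> i\<close> reads the screen coordinates through the inverse Gram matrix, and
    pairing the remainder with \<open>M\<close> reads the coefficient of \<open>k\<close>. As
    \<open>M\<close> may be neither null nor orthogonal to the frame, these subtractions come
    first.\<close>
  define \<phi> where "\<phi> i x = (if i < n then \<psi> i (P x)
      else if i = n then b (P x - (\<Sum>i<n. \<psi> i (P x) *\<^sub>R v i)) M else b x k)" for i x
  define f where "f i = (if i < n then v i else if i = n then k else M)" for i
  have P_lin: "linear P"
    by (rule linearI) (simp_all add: P_def lin algebra_simps)
  have \<psi>_lin: "linear (\<psi> i)" for i
    by (rule linearI) (simp_all add: \<psi>_def lin algebra_simps sum.distrib sum_distrib_left)
  note lin' = linear_add[OF P_lin] linear_cmul[OF P_lin] linear_add[OF \<psi>_lin] linear_cmul[OF \<psi>_lin]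
  have "linear (\<phi> i)" for i
    by (rule linearI)
      (auto simp: \<phi>_def lin lin' linear_sum[OF bl] algebra_simps sum.distrib sum_distrib_left)
  moreover have P_v: "P (v i) = v i" if "i < n" for i using v[OF that] by (simp add: P_def)
  have P_k: "P k = k" and P_M: "P M = 0" using k M by (simp_all add: P_def)
  have \<psi>_v: "\<psi> i (v l) = (if i = l then 1 else 0)" if "i < n" "l < n" for i l
    using inv[OF that(2,1)] by (auto simp: \<psi>_def)
  have \<psi>_k: "\<psi> i k = 0" for i using v sym by (simp add: \<psi>_def)
  have \<psi>_0: "\<psi> i 0 = 0" for i by (simp add: \<psi>_def lin)
  have "(\<Sum>i<n. \<psi> i (v l) *\<^sub>R v i) = v l" if "l < n" for l
  proof -
    have "(\<Sum>i<n. \<psi> i (v l) *\<^sub>R v i) = (\<Sum>i<n. if i = l then v i else 0)"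
      using that \<psi>_v by (intro sum.cong) auto
    then show ?thesis using that by simp
  qed
  then have "\<phi> i (f j) = (if i = j then 1 else 0)" if "i < n + 2" "j < n + 2" for i j
    using that \<psi>_v v k M sym
    by (auto simp: \<phi>_def f_def P_v P_k P_M \<psi>_k \<psi>_0 lin)
  ultimately have "trace (matrix L) = (\<Sum>i<n+2. \<phi> i (L (f i)))"
    using L(1) dim by (intro trace_biorthogonal) auto
  also have "\<dots> = (\<Sum>i<n. \<phi> i (L (f i))) + \<phi> n (L k) + \<phi> (Suc n) (L M)"
    by (simp add: f_def)
  also have "\<phi> n (L k) = c"
    using P_k k M sym by (simp add: \<phi>_def L(2) lin' \<psi>_k lin linear_cmul[OF br])
  also have "\<phi> (Suc n) (L M) = 0" by (simp add: \<phi>_def L(3))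
  also have "(\<Sum>i<n. \<phi> i (L (f i))) = (\<Sum>i<n. \<Sum>j<n. H i j * b (L (v i)) (v j))"
  proof (rule sum.cong[OF refl])
    fix i assume i: "i \<in> {..<n}"
    have "\<phi> i (L (f i)) = (\<Sum>j<n. b (L (v i)) (v j) * H j i)"
      using i by (simp add: \<phi>_def f_def P_def L(3) \<psi>_def)
    \<comment> \<open>The dual family produces \<open>H\<close> with its indices exchanged; symmetry
      of the inverse Gram matrix repairs this.\<close>
    also have "\<dots> = (\<Sum>j<n. H i j * b (L (v i)) (v j))"
      using i symmetric_right_inverse[of n "\<lambda>i j. b (v i) (v j)" H, OF sym inv]
      by (intro sum.cong) (auto simp: mult.commute)
    finally show "\<phi> i (L (f i)) = (\<Sum>j<n. H i j * b (L (v i)) (v j))" .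
  qed
  finally show ?thesis by simp
qed

section \<open>The derivative of a generator\<close>

lemma dir_deriv_zero: "dir_deriv A p v (\<lambda>q. 0) = 0"
  by (simp add: dir_deriv_def o_def)

text \<open>Invariance under shifts by \<open>K p\<close> makes \<open>B\<close> constant on the two
  classes; since they contain \<open>v\<close> and \<open>w\<close>, the described value is
  unique.\<close>

lemma descend_coset:
  assumes "0 \<in> K p" "\<And>x y. x \<in> K p \<Longrightarrow> y \<in> K p \<Longrightarrow> B (v + x) (w + y) = B v w"
  shows "descend B (coset K p v) (coset K p w) = B v w"
  unfolding descend_def
proof (rule the_equality)
  show "\<forall>v'\<in>coset K p v. \<forall>w'\<in>coset K p w. B v w = B v' w'"
    using assms(2) by (auto simp: coset_def)
  fix r assume "\<forall>v'\<in>coset K p v. \<forall>w'\<in>coset K p w. r = B v' w'"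
  moreover have "v \<in> coset K p v" "w \<in> coset K p w"
    using assms(1) by (force simp: coset_def)+
  ultimately show "r = B v w" by blast
qed

section \<open>Levi-Civita identities for a smooth field\<close>

context
  fixes A :: "('a::topological_space, 'm::finite) chart set"
    and g :: "'a \<Rightarrow> real^'m \<Rightarrow> real^'m \<Rightarrow> real"
    and nabla :: "'a \<Rightarrow> real^'m \<Rightarrow> ('a \<Rightarrow> real^'m) \<Rightarrow> real^'m"
    and k :: "'a \<Rightarrow> real^'m"
  assumes atlas: "oriented_smooth_atlas A"
    and metric: "lorentzian_metric A g"
    and lc: "levi_civita A g nabla"
    and k: "smooth_field_on A UNIV k"
begin

lemma metric_symmetric: "g p v w = g p w v"
  and metric_linear_left: "linear (\<lambda>v. g p v w)"
  and metric_linear_right: "linear (g p v)"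
  using metric by (auto simp: lorentzian_metric_def lorentzian_form_def bilinear_def)

lemma smooth_field_near_k: "smooth_field_near A p k"
  using k by (auto simp: smooth_field_near_def)

lemma metric_compatible:
  "smooth_field_near A p X \<Longrightarrow> smooth_field_near A p Y \<Longrightarrow>
    dir_deriv A p v (\<lambda>q. g q (X q) (Y q)) = g p (nabla p v X) (Y p) + g p (X p) (nabla p v Y)"
  using lc by (auto simp: levi_civita_def)

lemma torsion_free:
  "smooth_field_near A p X \<Longrightarrow> smooth_field_near A p Y \<Longrightarrow>
    lie_bracket A X Y p = nabla p (X p) Y - nabla p (Y p) X"
  using lc by (auto simp: levi_civita_def)

lemma linear_nabla_k: "linear (\<lambda>v. nabla p v k)"
  using lc smooth_field_near_k by (auto simp: levi_civita_def affine_connection_def)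

text \<open>Metric compatibility cancels the derivative of the extension \<open>Y\<close>, so the
  value depends on \<open>w\<close> alone; the existence of one extension makes it unique.\<close>

lemma cov_deriv_dual_form:
  "cov_deriv_form A nabla (dual_form g k) p v w = g p (nabla p v k) w"
proof -
  have *: "dir_deriv A p v (\<lambda>q. dual_form g k q (Y q)) - dual_form g k p (nabla p v Y)
      = g p (nabla p v k) w" if "smooth_field_near A p Y" "Y p = w" for Y
    using metric_compatible[OF smooth_field_near_k that(1)] that(2) by (simp add: dual_form_def)
  obtain Y0 where 0: "smooth_field_near A p Y0" "Y0 p = w"
    using smooth_field_extension[OF atlas] .
  show ?thesis
    unfolding cov_deriv_form_def
  proof (rule the_equality, goal_cases)
    case 1
    show ?case using * by simp
  next
    case (2 r)
    show ?case using spec[OF 2, of Y0] *[OF 0] 0 by simp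
  qed
qed

text \<open>Compatibility leaves \<open>g p (k p)\<close> applied to the difference of the covariant
  derivatives of \<open>Y\<close> and \<open>X\<close>, which vanishing torsion identifies with the
  bracket term.\<close>

lemma ext_deriv_dual_form:
  "ext_deriv_form A (dual_form g k) p v w = (g p (nabla p v k) w - g p (nabla p w k) v) / 2"
proof -
  have *: "(dir_deriv A p v (\<lambda>q. dual_form g k q (Y q)) - dir_deriv A p w (\<lambda>q. dual_form g k q (X q))
      - dual_form g k p (lie_bracket A X Y p)) / 2
      = (g p (nabla p v k) w - g p (nabla p w k) v) / 2"
    if "smooth_field_near A p X" "X p = v" "smooth_field_near A p Y" "Y p = w" for X Y
    using that metric_compatible[OF smooth_field_near_k that(1)]
      metric_compatible[OF smooth_field_near_k that(3)]
    by (simp add: dual_form_def torsion_free linear_diff[OF metric_linear_right])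
  obtain X0 Y0 where 0: "smooth_field_near A p X0" "X0 p = v" "smooth_field_near A p Y0" "Y0 p = w"
    using smooth_field_extension[OF atlas] by metis
  show ?thesis
    unfolding ext_deriv_form_def
  proof (rule the_equality, goal_cases)
    case 1
    show ?case using * by simp
  next
    case (2 r)
    show ?case using spec[OF spec[OF 2, of X0], of Y0] *[OF 0] 0 by simp
  qed
qed

text \<open>Writing the brackets through the connection, the derivatives of \<open>X\<close> and
  \<open>Y\<close> along \<open>k\<close> cancel by compatibility, and only derivatives of
  \<open>k\<close> remain.\<close>

lemma lie_deriv_metric_nabla:
  "lie_deriv_metric A g k p v w = g p (nabla p v k) w + g p (nabla p w k) v"
proof -
  have *: "dir_deriv A p (k p) (\<lambda>q. g q (X q) (Y q))
      - g p (lie_bracket A k X p) w - g p v (lie_bracket A k Y p)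
      = g p (nabla p v k) w + g p (nabla p w k) v"
    if "smooth_field_near A p X" "X p = v" "smooth_field_near A p Y" "Y p = w" for X Y
    using that metric_compatible[OF that(1,3)] metric_symmetric[of p v]
    by (simp add: torsion_free smooth_field_near_k
        linear_diff[OF metric_linear_right] linear_diff[OF metric_linear_left])
  obtain X0 Y0 where 0: "smooth_field_near A p X0" "X0 p = v" "smooth_field_near A p Y0" "Y0 p = w"
    using smooth_field_extension[OF atlas] by metis
  show ?thesis
    unfolding lie_deriv_metric_def
  proof (rule the_equality, goal_cases)
    case 1
    show ?case using * by simp
  next
    case (2 r)
    show ?case using spec[OF spec[OF 2, of X0], of Y0] *[OF 0] 0 by simp
  qed
qed

text \<open>The geodesic equation makes both sides of the defining equation multiples of the dual
  form; a vector on which that form is nonzero determines the factor.\<close>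

lemma expansion_eq:
  assumes "nabla p (k p) k = c *\<^sub>R k p" "k p \<noteq> 0"
  shows "expansion A g nabla k p = divergence nabla k p - c"
proof -
  obtain w where w: "g p (k p) w \<noteq> 0"
    using lorentzian_nondegenerate[of "g p" "k p"] metric assms(2)
    by (auto simp: lorentzian_metric_def)
  have cov: "cov_deriv_form A nabla (dual_form g k) p (k p) v = c * dual_form g k p v" for v
    by (simp add: cov_deriv_dual_form assms(1) dual_form_def linear_cmul[OF metric_linear_left])
  show ?thesis
    unfolding expansion_def cov
  proof (rule the_equality)
    fix r assume "\<forall>v. r * dual_form g k p v
        = dual_form g k p v * divergence nabla k p - c * dual_form g k p v"
    then have "r * dual_form g k p w = (divergence nabla k p - c) * dual_form g k p w"
      by (simp add: algebra_simps)
    then show "r = divergence nabla k p - c" using w by (simp add: dual_form_def)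
  qed (simp add: algebra_simps)
qed

section \<open>Descent to the screen space of a null geodesic generator\<close>

context
  fixes K :: "'a \<Rightarrow> (real^'m) set" and n :: nat and p :: 'a and c :: real
  assumes dim: "CARD('m) = n + 2"
    and K: "\<And>q. K q = span {k q}"
    and k_nonzero: "k p \<noteq> 0"
    and k_null: "\<And>q. g q (k q) (k q) = 0"
    and geodesic: "nabla p (k p) k = c *\<^sub>R k p"
begin

text \<open>Differentiate \<open>g q (k q) (k q) = 0\<close>, which is why nullity is assumed at
  every point and not only at \<open>p\<close>.\<close>

lemma metric_nabla_k_k: "g p (nabla p v k) (k p) = 0"
  using metric_compatible[OF smooth_field_near_k smooth_field_near_k, of p v]
    metric_symmetric[of p "k p"]
  by (simp add: k_null dir_deriv_zero)

lemma zero_in_K: "0 \<in> K p"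
  by (simp add: K span_zero)

lemma K_cases:
  assumes "x \<in> K p" obtains a where "x = a *\<^sub>R k p"
  using assms K by (auto simp: span_singleton)

lemma orth_iff: "v \<in> orth g K p \<longleftrightarrow> g p v (k p) = 0"
  by (auto simp: orth_def K span_singleton linear_cmul[OF metric_linear_right])

text \<open>Shifting \<open>v\<close> along \<open>k\<close> adds a multiple of \<open>k p\<close>
  to the derivative, by the geodesic equation, and \<open>k p\<close> is orthogonal to
  \<open>w + y\<close>. Shifting \<open>w\<close> adds a multiple of the vanishing product in
  \<open>metric_nabla_k_k\<close>.\<close>

lemma nabla_k_shift:
  assumes "v \<in> orth g K p" "w \<in> orth g K p" "x \<in> K p" "y \<in> K p"
  shows "g p (nabla p (v + x) k) (w + y) = g p (nabla p v k) w"
  using assms metric_nabla_k_k metric_symmetric[of p "k p"]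
  by (elim K_cases) (simp add: orth_iff linear_add[OF linear_nabla_k] linear_cmul[OF linear_nabla_k]
      linear_add[OF metric_linear_right] linear_cmul[OF metric_linear_right]
      linear_add[OF metric_linear_left] linear_cmul[OF metric_linear_left] geodesic k_null)

lemma metric_shift:
  assumes "v \<in> orth g K p" "w \<in> orth g K p" "x \<in> K p" "y \<in> K p"
  shows "g p (v + x) (w + y) = g p v w"
  using assms metric_symmetric[of p "k p"]
  by (elim K_cases) (simp add: orth_iff
      linear_add[OF metric_linear_right] linear_cmul[OF metric_linear_right]
      linear_add[OF metric_linear_left] linear_cmul[OF metric_linear_left] k_null)

lemma screen_metric_coset:
  assumes "v \<in> orth g K p" "w \<in> orth g K p"
  shows "screen_metric g p (coset K p v) (coset K p w) = g p v w"
  unfolding screen_metric_def using assms zero_in_K metric_shift by (intro descend_coset) auto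

lemma intrinsic_torsion_coset:
  "intrinsic_torsion A g nabla k p v (coset K p w) = g p (nabla p v k) w"
proof -
  have "g p (nabla p v k) w' = g p (nabla p v k) w" if "w' \<in> coset K p w" for w'
    using that metric_nabla_k_k
    by (auto simp: coset_def K span_singleton
        linear_add[OF metric_linear_right] linear_cmul[OF metric_linear_right])
  moreover have "w \<in> coset K p w" using zero_in_K by (force simp: coset_def)
  ultimately show ?thesis
    unfolding intrinsic_torsion_def cov_deriv_dual_form by (intro the_equality) metis+
qed

lemma graded_torsion_coset:
  assumes "v \<in> orth g K p" "w \<in> orth g K p"
  shows "graded_class (intrinsic_torsion A g nabla k p) (coset K p v) (coset K p w)
    = g p (nabla p v k) w"
proof -
  have "g p (nabla p v' k) w = g p (nabla p v k) w" if "v' \<in> coset K p v" for v'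
    using that nabla_k_shift[OF assms _ zero_in_K] by (auto simp: coset_def)
  moreover have "v \<in> coset K p v" using zero_in_K by (force simp: coset_def)
  ultimately show ?thesis
    unfolding graded_class_def intrinsic_torsion_coset by (intro the_equality) metis+
qed

lemma twist_coset:
  assumes "v \<in> orth g K p" "w \<in> orth g K p"
  shows "twist A g k p (coset K p v) (coset K p w)
    = (g p (nabla p v k) w - g p (nabla p w k) v) / 2"
  unfolding twist_def using assms zero_in_K nabla_k_shift
  by (subst descend_coset) (auto simp: ext_deriv_dual_form)

lemma shear_coset:
  assumes "v \<in> orth g K p" "w \<in> orth g K p"
  shows "shear n A g nabla k p (coset K p v) (coset K p w)
    = (g p (nabla p v k) w + g p (nabla p w k) v) / 2
      - 1 / real n * expansion A g nabla k p * g p v w"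
  unfolding shear_def using assms zero_in_K nabla_k_shift metric_shift
  by (subst descend_coset) (auto simp: lie_deriv_metric_nabla)

section \<open>Traces over screen frames\<close>

text \<open>Representatives of the frame have the same Gram matrix as their classes. So
  \<open>trace_null_frame\<close> gives the divergence as \<open>c\<close> plus the screen trace,
  and the expansion is the divergence minus \<open>c\<close>.\<close>

lemma trace_screen_frame:
  assumes e: "\<And>i. i < n \<Longrightarrow> e i \<in> screen g K p"
    and inv: "\<And>i j. i < n \<Longrightarrow> j < n \<Longrightarrow>
      (\<Sum>l<n. screen_metric g p (e i) (e l) * hinv l j) = (if i = j then 1 else 0)"
  shows "(\<Sum>i<n. \<Sum>j<n. hinv i j * graded_class (intrinsic_torsion A g nabla k p) (e i) (e j))
      = expansion A g nabla k p"
    and "\<And>i j. i < n \<Longrightarrow> j < n \<Longrightarrow> hinv i j = hinv j i"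
proof -
  have "\<exists>v. v \<in> orth g K p \<and> e i = coset K p v" if "i < n" for i
    using e[OF that] by (auto simp: screen_def)
  then obtain v where v: "\<And>i. i < n \<Longrightarrow> v i \<in> orth g K p" "\<And>i. i < n \<Longrightarrow> e i = coset K p (v i)"
    by metis
  have gram: "(\<Sum>l<n. g p (v i) (v l) * hinv l j) = (if i = j then 1 else 0)" if "i < n" "j < n" for i j
  proof -
    have "(\<Sum>l<n. g p (v i) (v l) * hinv l j) = (\<Sum>l<n. screen_metric g p (e i) (e l) * hinv l j)"
      using that(1) v screen_metric_coset by (intro sum.cong) auto
    then show ?thesis using inv[OF that] by simp
  qed
  show "hinv i j = hinv j i" if "i < n" "j < n" for i j
    using symmetric_right_inverse[of n "\<lambda>i j. g p (v i) (v j)" hinv] gram metric_symmetric that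
    by blast
  have "divergence nabla k p = c + (\<Sum>i<n. \<Sum>j<n. hinv i j * g p (nabla p (v i) k) (v j))"
    unfolding divergence_def
    using metric v gram linear_nabla_k geodesic metric_nabla_k_k k_null
    by (intro trace_null_frame[OF _ dim k_nonzero]) (auto simp: lorentzian_metric_def orth_iff)
  also have "(\<Sum>i<n. \<Sum>j<n. hinv i j * g p (nabla p (v i) k) (v j))
      = (\<Sum>i<n. \<Sum>j<n. hinv i j * graded_class (intrinsic_torsion A g nabla k p) (e i) (e j))"
    using v graded_torsion_coset by (intro sum.cong) auto
  finally show "(\<Sum>i<n. \<Sum>j<n. hinv i j * graded_class (intrinsic_torsion A g nabla k p) (e i) (e j))
      = expansion A g nabla k p"
    by (simp add: expansion_eq[OF geodesic k_nonzero])
qed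

text \<open>An orthonormal frame, whose Gram matrix is its own inverse, keeps the description in
  \<open>screen_trace\<close> from being vacuous.\<close>

lemma screen_frame_exists:
  obtains e hinv where "\<And>i. i < n \<Longrightarrow> e i \<in> screen g K p"
    "\<And>i j. i < n \<Longrightarrow> j < n \<Longrightarrow>
      (\<Sum>l<n. screen_metric g p (e i) (e l) * hinv l j) = (if i = j then 1 else 0)"
proof -
  obtain v where v: "\<And>i. i < n \<Longrightarrow> g p (k p) (v i) = 0"
    "\<And>i j. i < n \<Longrightarrow> j < n \<Longrightarrow> g p (v i) (v j) = (if i = j then 1 else 0)"
    using orthonormal_screen_frame[OF _ dim, of "g p" "k p"] metric
    unfolding lorentzian_metric_def by metis
  have orth: "v i \<in> orth g K p" if "i < n" for i
    using v(1)[OF that] metric_symmetric[of p "k p"] by (simp add: orth_iff)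
  show thesis
  proof (rule that[of "\<lambda>i. coset K p (v i)" "\<lambda>i j. if i = j then 1 else 0"])
    show "coset K p (v i) \<in> screen g K p" if "i < n" for i
      using orth[OF that] by (simp add: screen_def)
    show "(\<Sum>l<n. screen_metric g p (coset K p (v i)) (coset K p (v l)) * (if l = j then 1 else 0))
        = (if i = j then 1 else 0)" if "i < n" "j < n" for i j
      using that orth v(2) by (simp add: screen_metric_coset if_distrib[of "(*) _"] cong: if_cong)
  qed
qed

lemma screen_trace_eqI:
  assumes "\<And>e hinv. \<forall>i<n. e i \<in> screen g K p \<Longrightarrow> \<forall>i<n. \<forall>j<n.
      (\<Sum>l<n. screen_metric g p (e i) (e l) * hinv l j) = (if i = j then 1 else 0) \<Longrightarrow>
      (\<Sum>i<n. \<Sum>j<n. hinv i j * B (e i) (e j)) = s"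
  shows "screen_trace n g K p B = s"
proof -
  obtain e hinv where frame: "\<forall>i<n. e i \<in> screen g K p" "\<forall>i<n. \<forall>j<n.
      (\<Sum>l<n. screen_metric g p (e i) (e l) * hinv l j) = (if i = j then 1 else 0)"
    by (rule screen_frame_exists) blast
  show ?thesis
    unfolding screen_trace_def
  proof (rule the_equality, goal_cases)
    case 1
    show ?case using assms by simp
  next
    case (2 r)
    show ?case using spec[OF spec[OF 2, of e], of hinv] assms[OF frame] frame by simp
  qed
qed

lemma screen_trace_torsion:
  "screen_trace n g K p (graded_class (intrinsic_torsion A g nabla k p)) = expansion A g nabla k p"
  by (rule screen_trace_eqI, rule trace_screen_frame(1)) auto

lemma screen_trace_torsion_sym:
  "screen_trace n g K p (proj_sym (graded_class (intrinsic_torsion A g nabla k p)))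
    = expansion A g nabla k p"
proof (rule screen_trace_eqI)
  let ?B = "graded_class (intrinsic_torsion A g nabla k p)"
  show "(\<Sum>i<n. \<Sum>j<n. hinv i j * proj_sym ?B (e i) (e j)) = expansion A g nabla k p"
    if e: "\<forall>i<n. e i \<in> screen g K p" and inv: "\<forall>i<n. \<forall>j<n.
      (\<Sum>l<n. screen_metric g p (e i) (e l) * hinv l j) = (if i = j then 1 else 0)" for e hinv
  proof -
    have tr: "(\<Sum>i<n. \<Sum>j<n. hinv i j * ?B (e i) (e j)) = expansion A g nabla k p"
      by (rule trace_screen_frame(1)) (use e inv in blast)+
    have sym: "hinv i j = hinv j i" if "i < n" "j < n" for i j
      by (rule trace_screen_frame(2)[of e hinv]) (use e inv that in blast)+
    \<comment> \<open>Exchanging the names of the indices uses the symmetry of \<open>hinv\<close>;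
      thus symmetrization preserves the trace.\<close>
    have "(\<Sum>i<n. \<Sum>j<n. hinv i j * ?B (e j) (e i)) = (\<Sum>j<n. \<Sum>i<n. hinv i j * ?B (e j) (e i))"
      by (rule sum.swap)
    also have "\<dots> = (\<Sum>j<n. \<Sum>i<n. hinv j i * ?B (e j) (e i))"
      using sym by (intro sum.cong) auto
    finally have swap: "(\<Sum>i<n. \<Sum>j<n. hinv i j * ?B (e j) (e i)) = expansion A g nabla k p"
      using tr by simp
    have "(\<Sum>i<n. \<Sum>j<n. hinv i j * proj_sym ?B (e i) (e j))
        = ((\<Sum>i<n. \<Sum>j<n. hinv i j * ?B (e i) (e j)) + (\<Sum>i<n. \<Sum>j<n. hinv i j * ?B (e j) (e i))) / 2"
      by (simp add: proj_sym_def algebra_simps add_divide_distrib sum.distrib sum_divide_distrib)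
    then show ?thesis using tr swap by simp
  qed
qed

end

end

section \<open>From the line distribution to a generator, and the comparison of the sections\<close>

text \<open>A local spanning field and the generator are nonzero multiples of each other at
  \<open>p\<close>; they span the same line, and nullity survives rescaling.\<close>

lemma null_line_distribution_generator:
  assumes "lorentzian_metric A g" "null_line_distribution A g K" "generator A K k"
  shows "K p = span {k p}" "g p (k p) (k p) = 0"
proof -
  obtain l where l: "K p = span {l}" "g p l l = 0"
    using assms(2) unfolding null_line_distribution_def by metis
  have k: "k p \<in> K p" "k p \<noteq> 0" using assms(3) by (auto simp: generator_def)
  then obtain a where a: "k p = a *\<^sub>R l" using l(1) by (auto simp: span_singleton)
  with k(2) have "a \<noteq> 0" by auto
  have "(1 / a) *\<^sub>R k p \<in> span {k p}" by (simp add: span_base span_mul)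
  then have "l \<in> span {k p}" using a \<open>a \<noteq> 0\<close> by simp
  moreover have "k p \<in> span {l}" using k(1) l(1) by simp
  ultimately have "span {l} = span {k p}" by (simp add: span_eq)
  then show "K p = span {k p}" using l(1) by simp
  have "bilinear (g p)" using assms(1) by (simp add: lorentzian_metric_def lorentzian_form_def)
  then show "g p (k p) (k p) = 0"
    using l(2) a by (simp add: bilinear_lmul bilinear_rmul)
qed

text \<open>Sections of the weighted bundles coincide exactly when their representatives do, hence
  the comparison for each generator \<open>k\<close> and at each point \<open>p\<close>.\<close>

theorem proposition4p9:
  fixes A :: "('a::{t2_space,second_countable_topology}, 'm::finite) chart set"
    and g :: "'a \<Rightarrow> real^'m \<Rightarrow> real^'m \<Rightarrow> real"
    and t :: "'a \<Rightarrow> real^'m"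
    and K :: "'a \<Rightarrow> (real^'m) set"
    and nabla :: "'a \<Rightarrow> real^'m \<Rightarrow> ('a \<Rightarrow> real^'m) \<Rightarrow> real^'m"
    and n :: nat
  assumes "optical_geometry n A g t K"
    and "levi_civita A g nabla"
    and "geodesic_congruence A nabla K"
  shows "\<forall>k. generator A K k \<longrightarrow> (\<forall>p.
           expansion A g nabla k p =
             screen_trace n g K p (graded_class (intrinsic_torsion A g nabla k p)) \<and>
           (\<forall>P \<in> screen g K p. \<forall>Q \<in> screen g K p.
             twist A g k p P Q =
               proj_alt (graded_class (intrinsic_torsion A g nabla k p)) P Q) \<and>
           (\<forall>P \<in> screen g K p. \<forall>Q \<in> screen g K p.
             shear n A g nabla k p P Q =
               proj_sym_tracefree n g K p (graded_class (intrinsic_torsion A g nabla k p)) P Q))"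
proof (intro allI impI)
  fix k p
  assume gen: "generator A K k"
  have geom: "CARD('m) = n + 2" "oriented_smooth_atlas A" "lorentzian_metric A g"
      "null_line_distribution A g K"
    using assms(1) by (auto simp: optical_geometry_def)
  have k: "smooth_field_on A UNIV k" "k p \<noteq> 0" using gen by (auto simp: generator_def)
  note K = null_line_distribution_generator[OF geom(3,4) gen]
  have "nabla p (k p) k \<in> K p" using assms(3) gen by (simp add: geodesic_congruence_def)
  then obtain c where c: "nabla p (k p) k = c *\<^sub>R k p"
    using K(1) by (auto simp: span_singleton)
  \<comment> \<open>\<open>A1\<close> and \<open>A2\<close> discharge the assumptions of the outer
    and the inner context, in their order.\<close>
  note A1 = geom(2,3) assms(2) k(1)
  note A2 = geom(1) K(1) k(2) K(2) c
  show "expansion A g nabla k p =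
             screen_trace n g K p (graded_class (intrinsic_torsion A g nabla k p)) \<and>
           (\<forall>P \<in> screen g K p. \<forall>Q \<in> screen g K p.
             twist A g k p P Q =
               proj_alt (graded_class (intrinsic_torsion A g nabla k p)) P Q) \<and>
           (\<forall>P \<in> screen g K p. \<forall>Q \<in> screen g K p.
             shear n A g nabla k p P Q =
               proj_sym_tracefree n g K p (graded_class (intrinsic_torsion A g nabla k p)) P Q)"
    \<comment> \<open>Shear and trace-free projection subtract the same term with factor
      \<open>1 / real n\<close>, so the case \<open>n = 0\<close>, where this factor is 0, is
      covered too.\<close>
    unfolding proj_alt_def proj_sym_tracefree_def
      screen_trace_torsion[OF A1, OF A2] screen_trace_torsion_sym[OF A1, OF A2]
    by (auto simp: screen_def proj_sym_def graded_torsion_coset[OF A1, OF A2] twist_coset[OF A1, OF A2]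
        shear_coset[OF A1, OF A2] screen_metric_coset[OF A1, OF A2])
qed

end
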